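(* Let $X$ be a Banach space and let $\phi:\mathbb{N}_0\to(0,\infty)$ be a sequence such that $\phi(n)\le Ca^n$ for all $n$, for some $C>0$ and $a>0$. Let $f:\mathbb{N}_0\to X$ be a vector-valued sequence. The following assertions are equivalent: (i) $\sup_{n\in\mathbb{N}_0}\frac{\|f(n)\|}{\phi(n)}<\infty$. (ii) The $Z$-transform $\tilde f(\lambda)$ converges for $\lambda>a$ and there exists a bounded linear map $\theta:\ell^1_\phi\to X$ such that $\theta(\lambda p_\lambda)=\tilde f(\lambda)$ for $\lambda>a$. (iii) The $Z$-transform $\tilde f(\lambda)$ converges for $\lambda>a$ and $\tilde f\circ\exp\in C^\infty_W((\log a,\infty),X;\phi)$.
   Context: $\mathbb{N}_0=\{0,1,2,\dots\}$. The $Z$-transform of $f:\mathbb{N}_0\to X$ is $\tilde f(z)=\sum_{n=0}^\infty f(n)z^{-n}$ where the series converges. $\ell^1_\phi$ is the Banach space of complex sequences $g$ with $\|g\|_{1,\phi}=\sum_{n}\phi(n)|g(n)|<\infty$. For $\lambda\ne0$, $p_\lambda(n)=\lambda^{-(n+1)}$, $n\in\mathbb{N}_0$. Put $\omega=\log a$ and, for $k\in\mathbb{N}_0$, $\lambda>\omega$, let $\beta_{k,\lambda}(n)=n^ke^{-\lambda n}$ for $n\in\mathbb{N}_0$ (with $0^0=1$). Let $C^\infty((\omega,\infty),X)$ be the space of $X$-valued functions on $(\omega,\infty)$ infinitely differentiable in the norm topology of $X$. For $r\in C^\infty((\omega,\infty),X)$ put $$\|r\|_{W,\phi,\omega}=\sup\left\{\frac{\|r^{(k)}(\lambda)\|}{\|\beta_{k,\lambda}\|_{1,\phi}}\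 :\ k\in\mathbb{N}_0,\ \lambda>\omega\right\}.$$ The Widder space is $C^\infty_W((\omega,\infty),X;\phi)=\{r\in C^\infty((\omega,\infty),X):\|r\|_{W,\phi,\omega}<\infty\}$. *)

theory Defs
  imports "HOL-Analysis.Analysis"
begin

text \<open>Complex Banach spaces: the library's class \<open>banach\<close> is over the reals, so we add a
  complex scalar multiplication that extends \<open>scaleR\<close>.\<close>

class scaleC = scaleR +
  fixes scaleC :: "complex \<Rightarrow> 'a \<Rightarrow> 'a" (infixr \<open>*\<^sub>C\<close> 75)
  assumes scaleR_scaleC: "scaleR r x = scaleC (complex_of_real r) x"

class cbanach = banach + scaleC +
  assumes scaleC_add_right: "a *\<^sub>C (x + y) = a *\<^sub>C x + a *\<^sub>C y"
    and scaleC_add_left: "(a + b) *\<^sub>C x = a *\<^sub>C x + b *\<^sub>C x"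
    and scaleC_scaleC: "a *\<^sub>C (b *\<^sub>C x) = (a * b) *\<^sub>C x"
    and norm_scaleC: "norm (a *\<^sub>C x) = cmod a * norm x"

instantiation complex :: cbanach
begin

definition scaleC_complex :: "complex \<Rightarrow> complex \<Rightarrow> complex" where
  "scaleC_complex a x = a * x"

instance
  by standard (simp_all add: scaleC_complex_def scaleR_conv_of_real algebra_simps norm_mult)

end

definition l1 :: "(nat \<Rightarrow> real) \<Rightarrow> (nat \<Rightarrow> complex) set" where
  "l1 \<phi> = {g. summable (\<lambda>n. \<phi> n * cmod (g n))}"

definition l1_norm :: "(nat \<Rightarrow> real) \<Rightarrow> (nat \<Rightarrow> complex) \<Rightarrow> real" where
  "l1_norm \<phi> g = (\<Sum>n. \<phi> n * cmod (g n))"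

text \<open>Bounded linear maps defined on \<open>l1 \<phi>\<close>; values of \<open>\<theta>\<close> outside \<open>l1 \<phi>\<close> are irrelevant.\<close>

definition bounded_clinear_l1 ::
    "(nat \<Rightarrow> real) \<Rightarrow> ((nat \<Rightarrow> complex) \<Rightarrow> 'a::cbanach) \<Rightarrow> bool" where
  "bounded_clinear_l1 \<phi> \<theta> \<longleftrightarrow>
     (\<forall>g\<in>l1 \<phi>. \<forall>h\<in>l1 \<phi>. \<theta> (\<lambda>n. g n + h n) = \<theta> g + \<theta> h) \<and>
     (\<forall>c. \<forall>g\<in>l1 \<phi>. \<theta> (\<lambda>n. c * g n) = c *\<^sub>C \<theta> g) \<and>
     (\<exists>K. \<forall>g\<in>l1 \<phi>. norm (\<theta> g) \<le> K * l1_norm \<phi> g)"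

definition ztransform_converges :: "(nat \<Rightarrow> 'a::cbanach) \<Rightarrow> complex \<Rightarrow> bool" where
  "ztransform_converges f z \<longleftrightarrow> summable (\<lambda>n. (z powi (- int n)) *\<^sub>C f n)"

definition ztransform :: "(nat \<Rightarrow> 'a::cbanach) \<Rightarrow> complex \<Rightarrow> 'a" where
  "ztransform f z = (\<Sum>n. (z powi (- int n)) *\<^sub>C f n)"

definition p_seq :: "complex \<Rightarrow> nat \<Rightarrow> complex" where
  "p_seq l n = l powi (- (int n + 1))"

definition beta_seq :: "nat \<Rightarrow> real \<Rightarrow> nat \<Rightarrow> complex" where
  "beta_seq k l n = complex_of_real (real n ^ k * exp (- l * real n))"

definition iter_deriv :: "nat \<Rightarrow> (real \<Rightarrow> 'a::real_normed_vector) \<Rightarrow> real \<Rightarrow> 'a" where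
  "iter_deriv k r = ((\<lambda>g t. vector_derivative g (at t)) ^^ k) r"

text \<open>Functions on \<open>(\<omega>, \<infinity>)\<close> are total functions whose values outside this open interval
  are irrelevant. \<open>vector_derivative\<close> is an unspecified value where no derivative exists, hence
  the explicit differentiability of every iterate.\<close>

definition C_infinity :: "real \<Rightarrow> (real \<Rightarrow> 'a::real_normed_vector) set" where
  "C_infinity \<omega> = {r. \<forall>k. \<forall>t>\<omega>. iter_deriv k r differentiable (at t)}"

text \<open>The supremum is taken in the extended nonnegative reals, so that it always exists and
  may be infinite.\<close>

definition widder_norm :: "(nat \<Rightarrow> real) \<Rightarrow> real \<Rightarrow> (real \<Rightarrow> 'a::real_normed_vector) \<Rightarrow> ennreal" where
  "widder_norm \<phi> \<omega> r =
     (SUP (k, l) \<in> UNIV \<times> {\<omega><..}.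
        ennreal (norm (iter_deriv k r l) / l1_norm \<phi> (beta_seq k l)))"

definition widder_space :: "(nat \<Rightarrow> real) \<Rightarrow> real \<Rightarrow> (real \<Rightarrow> 'a::real_normed_vector) set" where
  "widder_space \<phi> \<omega> = {r \<in> C_infinity \<omega>. widder_norm \<phi> \<omega> r < \<infinity>}"

end

(* Writing \<lambda> = exp t turns the Z-transform into the Dirichlet series with terms exp (- t m) f m,
   whose k-th derivative has the terms (- m) ^ k exp (- t m) f m. The derivative bounds follow from
   the bound on f term by term. Conversely, at t = k / n the weights m ^ k exp (- t m), divided by
   their value at m = n, decrease to the indicator of n as k grows; dominated convergence turns
   the bound on the k-th derivative into the bound on f n (the Post-Widder idea). The same
   localisation shows that a vanishing Dirichlet series has zero coefficients, which identifies
   f n with the value of the bounded map \<theta> at the n-th unit sequence. *)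

theory Submission
  imports Defs
begin

section \<open>Dominated convergence for series\<close>

text \<open>By the Weierstrass M-test the partial sums converge uniformly in \<open>j\<close>, so
  the limit in \<open>j\<close> and the limit of the partial sums may be exchanged.\<close>

lemma suminf_dominated_convergence:
  fixes a :: "nat \<Rightarrow> nat \<Rightarrow> 'a::banach"
  assumes lim: "\<And>m. (\<lambda>j. a j m) \<longlonglongrightarrow> b m"
    and bound: "\<And>j m. norm (a j m) \<le> M m"
    and M: "summable M"
  shows "(\<lambda>j. \<Sum>m. a j m) \<longlonglongrightarrow> (\<Sum>m. b m)"
proof -
  have b: "norm (b m) \<le> M m" for m
    by (rule Lim_norm_ubound[OF _ lim]) (simp_all add: bound)
  then have sb: "summable b"
    by (intro summable_comparison_test'[OF M])
  show ?thesis
  proof (rule swap_uniform_limit')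
    show "uniform_limit UNIV (\<lambda>n j. \<Sum>m<n. a j m) (\<lambda>j. \<Sum>m. a j m) sequentially"
      by (rule Weierstrass_m_test[OF bound M])
    show "\<forall>\<^sub>F n in sequentially. (\<lambda>j. \<Sum>m<n. a j m) \<longlonglongrightarrow> (\<Sum>m<n. b m)"
      by (intro always_eventually allI tendsto_sum lim)
    show "(\<lambda>n. \<Sum>m<n. b m) \<longlonglongrightarrow> (\<Sum>m. b m)"
      by (rule summable_LIMSEQ[OF sb])
  qed auto
qed

section \<open>Dirichlet series and their derivatives\<close>

definition dirichlet :: "nat \<Rightarrow> (nat \<Rightarrow> 'a::banach) \<Rightarrow> real \<Rightarrow> 'a" where
  "dirichlet k f t = (\<Sum>m. ((- real m) ^ k * exp (- t * real m)) *\<^sub>R f m)"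

definition abs_conv_beyond :: "real \<Rightarrow> (nat \<Rightarrow> 'a::real_normed_vector) \<Rightarrow> bool" where
  "abs_conv_beyond \<omega> f \<longleftrightarrow> (\<forall>t>\<omega>. summable (\<lambda>m. exp (- t * real m) * norm (f m)))"

text \<open>The half-line of convergence is open, so each factor \<open>m\<close> can be paid for by
  moving \<open>t\<close> a little towards \<omega>: \<open>e * m \<le> exp (e * m)\<close>.\<close>

lemma abs_conv_beyond_power:
  assumes "abs_conv_beyond \<omega> f" "t > \<omega>"
  shows "summable (\<lambda>m. real m ^ k * exp (- t * real m) * norm (f m))"
  using \<open>t > \<omega>\<close>
proof (induction k arbitrary: t)
  case 0
  then show ?case using assms(1) by (simp add: abs_conv_beyond_def)
next
  case (Suc k)
  \<comment> \<open>Half of the distance to \<omega>: the point \<open>t - e\<close> still lies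
    beyond \<omega>, where the induction hypothesis applies.\<close>
  define e where "e = (t - \<omega>) / 2"
  have e: "e > 0" "t - e > \<omega>" using Suc.prems by (auto simp: e_def field_simps)
  show ?case
  proof (rule summable_comparison_test')
    show "summable (\<lambda>m. (1 / e) * (real m ^ k * exp (- (t - e) * real m) * norm (f m)))"
      by (intro summable_mult Suc.IH e)
    fix m :: nat
    have "e * real m \<le> exp (e * real m)"
      using exp_ge_add_one_self[of "e * real m"] by linarith
    then have "real m \<le> (1 / e) * exp (e * real m)"
      using e by (simp add: field_simps)
    then have "real m * (real m ^ k * exp (- t * real m) * norm (f m))
      \<le> (1 / e) * exp (e * real m) * (real m ^ k * exp (- t * real m) * norm (f m))"
      by (rule mult_right_mono) simp
    also have "\<dots> = (1 / e) * (real m ^ k * (exp (e * real m) * exp (- t * real m)) * norm (f m))"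
      by (simp only: mult_ac)
    also have "exp (e * real m) * exp (- t * real m) = exp (- (t - e) * real m)"
      by (simp add: algebra_simps flip: exp_add)
    finally show "norm (real m ^ Suc k * exp (- t * real m) * norm (f m))
      \<le> (1 / e) * (real m ^ k * exp (- (t - e) * real m) * norm (f m))"
      by (simp add: mult.assoc abs_mult)
  qed
qed

lemma summable_dirichlet:
  fixes f :: "nat \<Rightarrow> 'a::banach"
  assumes "abs_conv_beyond \<omega> f" "t > \<omega>"
  shows "summable (\<lambda>m. ((- real m) ^ k * exp (- t * real m)) *\<^sub>R f m)"
  by (rule summable_norm_cancel)
    (use abs_conv_beyond_power[OF assms, of k] in \<open>simp add: abs_mult power_abs\<close>)

text \<open>Termwise differentiation is allowed because the differentiated series converges
  uniformly on a half-line around \<open>t\<close>.\<close>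

lemma has_vector_derivative_dirichlet:
  fixes f :: "nat \<Rightarrow> 'a::banach"
  assumes f: "abs_conv_beyond \<omega> f" and t: "t > \<omega>"
  shows "(dirichlet k f has_vector_derivative dirichlet (Suc k) f t) (at t)"
proof -
  \<comment> \<open>The midpoint leaves room on both sides: the differentiated series converges
    absolutely at \<open>s\<close> and its terms there dominate those at every larger point.\<close>
  define s where "s = (\<omega> + t) / 2"
  have s: "s > \<omega>" "s < t" using t by (auto simp: s_def)
  define F where "F = (\<lambda>m x. ((- real m) ^ k * exp (- x * real m)) *\<^sub>R f m)"
  define F' where "F' = (\<lambda>m x. ((- real m) ^ Suc k * exp (- x * real m)) *\<^sub>R f m)"
  have unif: "uniform_limit {s<..} (\<lambda>n x. \<Sum>m<n. F' m x) (dirichlet (Suc k) f) sequentially"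
    unfolding dirichlet_def F'_def
  proof (rule Weierstrass_m_test)
    show "summable (\<lambda>m. real m ^ Suc k * exp (- s * real m) * norm (f m))"
      by (rule abs_conv_beyond_power[OF f s(1)])
    fix m x assume "x \<in> {s<..}"
    then have "exp (- x * real m) \<le> exp (- s * real m)"
      by (simp add: mult_right_mono)
    then show "norm (((- real m) ^ Suc k * exp (- x * real m)) *\<^sub>R f m)
        \<le> real m ^ Suc k * exp (- s * real m) * norm (f m)"
      by (simp add: abs_mult power_abs mult_left_mono mult_right_mono del: power_Suc)
  qed
  have "\<exists>g. \<forall>x\<in>{s<..}. (\<lambda>m. F m x) sums g x \<and>
      (g has_derivative (\<lambda>h. h *\<^sub>R dirichlet (Suc k) f x)) (at x within {s<..})"
  proof (rule has_derivative_series)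
    show "(F m has_derivative (\<lambda>h. h *\<^sub>R F' m x)) (at x within {s<..})" for m x
      unfolding F_def F'_def
      by (auto intro!: derivative_eq_intros simp: algebra_simps)
    \<comment> \<open>Each derivative is the map \<open>h \<mapsto> h *\<^sub>R v\<close>, so the
      bound on linear maps demanded here reduces to uniform closeness of the values
      \<open>v\<close>.\<close>
    show "\<forall>\<^sub>F n in sequentially. \<forall>x\<in>{s<..}. \<forall>h.
        norm ((\<Sum>m<n. h *\<^sub>R F' m x) - h *\<^sub>R dirichlet (Suc k) f x) \<le> e * norm h"
      if "e > 0" for e
      using uniform_limitD[OF unif that]
    proof eventually_elim
      case (elim n)
      show ?case
      proof (intro ballI allI)
        fix x h assume "x \<in> {s<..}"
        with elim have "norm ((\<Sum>m<n. F' m x) - dirichlet (Suc k) f x) \<le> e"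
          by (force simp: dist_norm)
        then show "norm ((\<Sum>m<n. h *\<^sub>R F' m x) - h *\<^sub>R dirichlet (Suc k) f x) \<le> e * norm h"
          by (simp add: mult.commute[of e] mult_left_mono flip: scaleR_sum_right scaleR_diff_right)
      qed
    qed
    show "t \<in> {s<..}" using s by simp
    show "(\<lambda>m. F m t) sums dirichlet k f t"
      unfolding F_def dirichlet_def by (rule summable_sums[OF summable_dirichlet[OF f t]])
  qed simp
  then obtain g where g: "\<And>x. x > s \<Longrightarrow> (\<lambda>m. F m x) sums g x"
      and g': "\<And>x. x > s \<Longrightarrow>
        (g has_derivative (\<lambda>h. h *\<^sub>R dirichlet (Suc k) f x)) (at x within {s<..})"
    by auto
  \<comment> \<open>On the open set \<open>{s<..}\<close> the derivative within the set is the full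
    derivative, and there \<open>g\<close> agrees with \<open>dirichlet k f\<close>.\<close>
  have "(g has_vector_derivative dirichlet (Suc k) f t) (at t)"
    using g'[OF s(2)] s by (simp add: has_vector_derivative_def at_within_open[of t "{s<..}"])
  then show ?thesis
    by (rule has_vector_derivative_transform_within_open[where S = "{s<..}"])
      (use g s in \<open>auto simp: F_def dirichlet_def sums_iff\<close>)
qed

lemma iter_deriv_dirichlet:
  fixes f :: "nat \<Rightarrow> 'a::banach"
  assumes f: "abs_conv_beyond \<omega> f" and r: "\<And>t. t > \<omega> \<Longrightarrow> r t = dirichlet 0 f t" and t: "t > \<omega>"
  shows "iter_deriv k r t = dirichlet k f t"
    and "(iter_deriv k r has_vector_derivative dirichlet (Suc k) f t) (at t)"
proof -
  \<comment> \<open>Stated for any \<open>g\<close> that agrees with the series beyond \<omega>,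
    since that is all that is known of \<open>iter_deriv k r\<close>; differentiation is
    local.\<close>
  have deriv: "(g has_vector_derivative dirichlet (Suc k) f t) (at t)"
    if "\<And>t. t > \<omega> \<Longrightarrow> g t = dirichlet k f t" "t > \<omega>" for g k t
    by (rule has_vector_derivative_transform_within_open
        [OF has_vector_derivative_dirichlet[OF f], where S = "{\<omega><..}"]) (use that in auto)
  have eq: "\<forall>t>\<omega>. iter_deriv k r t = dirichlet k f t" for k
  proof (induction k)
    case 0
    then show ?case using r by (simp add: iter_deriv_def)
  next
    case (Suc k)
    then show ?case
      using deriv[of "iter_deriv k r" k]
      by (auto simp: iter_deriv_def intro!: vector_derivative_at)
  qed
  show "iter_deriv k r t = dirichlet k f t" using eq t by blast
  show "(iter_deriv k r has_vector_derivative dirichlet (Suc k) f t) (at t)"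
    using deriv eq t by blast
qed

section \<open>Recovering the coefficients by localisation\<close>

text \<open>The weights tend to the indicator of \<open>n\<close> and are dominated by
  \<open>w 0\<close>, so both sides of the averaged inequality converge to their values at
  \<open>n\<close>.\<close>

lemma norm_le_of_concentrating_weights:
  fixes f :: "nat \<Rightarrow> 'a::banach" and \<phi> :: "nat \<Rightarrow> real"
  assumes w: "\<And>j m. 0 \<le> w j m" "\<And>j m. w j m \<le> w 0 m"
    and conc: "\<And>m. (\<lambda>j. w j m) \<longlonglongrightarrow> (if m = n then 1 else 0)"
    and f: "summable (\<lambda>m. w 0 m * norm (f m))"
    and \<phi>: "summable (\<lambda>m. w 0 m * \<bar>\<phi> m\<bar>)"
    and le: "\<And>j. norm (\<Sum>m. w j m *\<^sub>R f m) \<le> M * (\<Sum>m. w j m * \<phi> m)"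
  shows "norm (f n) \<le> M * \<phi> n"
proof -
  \<comment> \<open>Kept generic in the Banach space, because it is applied both to \<open>f\<close>
    and to the real sequence \<phi>.\<close>
  have lim: "(\<lambda>j. \<Sum>m. w j m *\<^sub>R g m) \<longlonglongrightarrow> g n" if "summable (\<lambda>m. w 0 m * norm (g m))"
    for g :: "nat \<Rightarrow> 'c::banach"
  proof -
    have "(\<lambda>j. \<Sum>m. w j m *\<^sub>R g m) \<longlonglongrightarrow> (\<Sum>m. (if m = n then 1 else 0) *\<^sub>R g m)"
      by (rule suminf_dominated_convergence[OF tendsto_scaleR[OF conc tendsto_const] _ that])
        (simp add: w mult_right_mono)
    also have "(\<Sum>m. (if m = n then 1 else 0) *\<^sub>R g m) = (\<Sum>m\<in>{n}. (if m = n then 1 else 0) *\<^sub>R g m)"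
      by (rule suminf_finite) auto
    finally show ?thesis by simp
  qed
  have "(\<lambda>j. norm (\<Sum>m. w j m *\<^sub>R f m)) \<longlonglongrightarrow> norm (f n)"
    by (intro tendsto_norm lim f)
  moreover have "(\<lambda>j. M * (\<Sum>m. w j m * \<phi> m)) \<longlonglongrightarrow> M * \<phi> n"
    using lim[of \<phi>] \<phi> by (intro tendsto_mult_left) simp
  ultimately show ?thesis
    by (rule LIMSEQ_le) (use le in blast)
qed

text \<open>For positive \<open>x\<close> this is the strict form of
  \<open>ln x \<le> x - 1\<close>, where equality holds only at 1; otherwise the product is
  nonpositive. It makes the normalised weights decay away from their peak.\<close>

lemma mult_exp_one_minus_less_one:
  fixes x :: real
  assumes "x \<noteq> 1"
  shows "x * exp (1 - x) < 1"
proof (cases "x > 0")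
  case True
  then have "ln x < x - 1"
    using ln_le_minus_one[of x] ln_eq_minus_one[of x] assms by force
  then have "exp (ln x) < exp (x - 1)"
    by (simp only: exp_less_cancel_iff)
  with True show ?thesis
    by (simp add: exp_diff field_simps)
next
  case False
  then have "x * exp (1 - x) \<le> 0"
    by (simp add: mult_nonpos_nonneg)
  then show ?thesis by linarith
qed

text \<open>For \<open>n > 0\<close> the weights \<open>m\<^sup>k exp (- (k / n) m)\<close>, normalised by their value at \<open>m = n\<close>,
  are \<open>(x exp (1 - x)) ^ k\<close> with \<open>x = m / n\<close>, so they concentrate at \<open>n\<close> as \<open>k\<close> grows.
  For \<open>n = 0\<close> one takes \<open>k = 0\<close> and lets \<open>t\<close> grow instead.\<close>

lemma norm_le_of_dirichlet_le:
  fixes f :: "nat \<Rightarrow> 'a::banach" and \<phi> :: "nat \<Rightarrow> real"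
  assumes f: "abs_conv_beyond \<omega> f" and \<phi>: "abs_conv_beyond \<omega> \<phi>"
    and le: "\<And>k t. t > \<omega> \<Longrightarrow>
      norm (dirichlet k f t) \<le> M * (\<Sum>m. real m ^ k * exp (- t * real m) * \<phi> m)"
  shows "norm (f n) \<le> M * \<phi> n"
proof (cases "n = 0")
  case True
  obtain t where t: "t > \<omega>" by (rule gt_ex[THEN exE])
  define w where "w = (\<lambda>j m. exp (- (t + real j) * real m))"
  show ?thesis
  proof (rule norm_le_of_concentrating_weights[where w = w])
    show "0 \<le> w j m" "w j m \<le> w 0 m" for j m
      by (simp_all add: w_def algebra_simps)
    show "(\<lambda>j. w j m) \<longlonglongrightarrow> (if m = n then 1 else 0)" for m
    proof (cases "m = 0")
      case False
      have "(\<lambda>j. exp (- t * real m) * exp (- real m) ^ j) \<longlonglongrightarrow> exp (- t * real m) * 0"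
        using False by (intro tendsto_mult_left LIMSEQ_realpow_zero) simp_all
      also have "(\<lambda>j. exp (- t * real m) * exp (- real m) ^ j) = (\<lambda>j. w j m)"
        by (auto simp: w_def algebra_simps simp flip: exp_of_nat_mult exp_add)
      finally show ?thesis using False \<open>n = 0\<close> by simp
    qed (simp add: w_def \<open>n = 0\<close>)
    show "summable (\<lambda>m. w 0 m * norm (f m))" "summable (\<lambda>m. w 0 m * \<bar>\<phi> m\<bar>)"
      using f \<phi> t by (simp_all add: abs_conv_beyond_def w_def)
    show "norm (\<Sum>m. w j m *\<^sub>R f m) \<le> M * (\<Sum>m. w j m * \<phi> m)" for j
      using le[of "t + real j" 0] t by (simp add: dirichlet_def w_def)
  qed
next
  case False
  define q where "q = (\<lambda>m. (real m / real n) * exp (1 - real m / real n))"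
  \<comment> \<open>The shift by \<open>k0\<close> keeps every point \<open>k / n\<close> beyond
    \<omega>, where the hypotheses apply.\<close>
  obtain k0 :: nat where k0: "\<omega> * real n < real k0"
    using reals_Archimedean2 by blast
  define k where "k = (\<lambda>j. j + k0)"
  define t where "t = (\<lambda>j. real (k j) / real n)"
  \<comment> \<open>The reciprocal of the weight \<open>n ^ k * exp (- k)\<close> attained at
    \<open>m = n\<close>.\<close>
  define c where "c = (\<lambda>j. (exp 1 / real n) ^ k j)"
  have t: "t j > \<omega>" for j
    using k0 False by (simp add: t_def k_def less_divide_eq)
  have c: "c j > 0" for j
    using False by (simp add: c_def)
  have q_pow: "q m ^ k j = c j * (real m ^ k j * exp (- t j * real m))" for j m
  proof -
    have "q m ^ k j = (real m / real n) ^ k j * exp (real (k j) * (1 - real m / real n))"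
      by (simp only: q_def power_mult_distrib exp_of_nat_mult)
    also have "real (k j) * (1 - real m / real n) = real (k j) + (- t j * real m)"
      by (simp add: t_def right_diff_distrib)
    also have "(real m / real n) ^ k j * exp \<dots>
        = (exp (real (k j)) / real n ^ k j) * (real m ^ k j * exp (- t j * real m))"
      by (simp only: exp_add power_divide mult_ac times_divide_eq_left times_divide_eq_right)
    also have "exp (real (k j)) / real n ^ k j = c j"
      using exp_of_nat_mult[of "k j" "1 :: real"] by (simp add: c_def power_divide)
    finally show ?thesis .
  qed
  have q0: "0 \<le> q m" for m
    by (simp add: q_def)
  have qn: "q n = 1"
    using False by (simp add: q_def)
  have q1: "q m < 1" if "m \<noteq> n" for m
    unfolding q_def by (rule mult_exp_one_minus_less_one) (use that False in simp)
  have q_le: "q m \<le> 1" for m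
    using q1[of m] qn by (cases "m = n") auto
  show ?thesis
  proof (rule norm_le_of_concentrating_weights[where w = "\<lambda>j m. q m ^ k j"])
    show "0 \<le> q m ^ k j" "q m ^ k j \<le> q m ^ k 0" for j m
      using q0 q_le by (simp_all add: power_decreasing k_def)
    show "(\<lambda>j. q m ^ k j) \<longlonglongrightarrow> (if m = n then 1 else 0)" for m
    proof (cases "m = n")
      case False
      then show ?thesis
        unfolding k_def
        using LIMSEQ_ignore_initial_segment[OF LIMSEQ_realpow_zero[OF q0 q1]] by simp
    qed (simp add: qn)
    show "summable (\<lambda>m. q m ^ k 0 * norm (f m))"
      using summable_mult[OF abs_conv_beyond_power[OF f t], of "c 0" "k 0" 0]
      by (simp only: q_pow mult.assoc)
    show "summable (\<lambda>m. q m ^ k 0 * \<bar>\<phi> m\<bar>)"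
      using summable_mult[OF abs_conv_beyond_power[OF \<phi> t], of "c 0" "k 0" 0]
      by (simp only: q_pow mult.assoc real_norm_def)
    show "norm (\<Sum>m. q m ^ k j *\<^sub>R f m) \<le> M * (\<Sum>m. q m ^ k j * \<phi> m)" for j
    proof -
      \<comment> \<open>The derivative carries \<open>(- m) ^ k\<close> while the weights carry
        \<open>m ^ k\<close>; the common sign \<open>(- 1) ^ k\<close> leaves the series and
        disappears under the norm.\<close>
      have sign: "(- 1) ^ k j * (- real m) ^ k j = real m ^ k j" for m
        by (simp flip: power_mult_distrib)
      have "(\<Sum>m. q m ^ k j *\<^sub>R f m)
          = (\<Sum>m. (c j * (- 1) ^ k j) *\<^sub>R ((- real m) ^ k j * exp (- t j * real m)) *\<^sub>R f m)"
        unfolding q_pow sign[symmetric] by (simp only: scaleR_scaleR mult_ac)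
      also have "\<dots> = (c j * (- 1) ^ k j) *\<^sub>R dirichlet (k j) f (t j)"
        unfolding dirichlet_def
        by (rule bounded_linear.suminf[OF bounded_linear_scaleR_right summable_dirichlet[OF f t], symmetric])
      finally have "norm (\<Sum>m. q m ^ k j *\<^sub>R f m) = c j * norm (dirichlet (k j) f (t j))"
        using c[of j] by (simp add: abs_mult power_abs)
      also have "\<dots> \<le> c j * (M * (\<Sum>m. real m ^ k j * exp (- t j * real m) * \<phi> m))"
        using le[OF t] c[of j] by (intro mult_left_mono) auto
      also have "\<dots> = M * (c j * (\<Sum>m. real m ^ k j * exp (- t j * real m) * \<phi> m))"
        by simp
      also have "c j * (\<Sum>m. real m ^ k j * exp (- t j * real m) * \<phi> m) = (\<Sum>m. q m ^ k j * \<phi> m)"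
      proof -
        have "summable (\<lambda>m. real m ^ k j * exp (- t j * real m) * \<phi> m)"
          by (rule summable_rabs_cancel)
            (use abs_conv_beyond_power[OF \<phi> t, where k = "k j"] in \<open>simp add: abs_mult\<close>)
        from suminf_mult[OF this, of "c j"] show ?thesis
          by (simp only: q_pow mult.assoc)
      qed
      finally show ?thesis .
    qed
  qed
qed

text \<open>All derivatives of the series vanish together with it, so the localisation bound applies
  with \<open>M\<close> and \<phi> both zero.\<close>

lemma dirichlet_zero_imp_zero:
  fixes f :: "nat \<Rightarrow> 'a::banach"
  assumes f: "abs_conv_beyond \<omega> f" and zero: "\<And>t. t > \<omega> \<Longrightarrow> dirichlet 0 f t = 0"
  shows "f n = 0"
proof -
  have "iter_deriv k (\<lambda>_. 0 :: 'a) = (\<lambda>_. 0)" for k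
    by (induction k) (simp_all add: iter_deriv_def)
  then have "dirichlet k f t = 0" if "t > \<omega>" for k t
    using iter_deriv_dirichlet(1)[OF f, of "\<lambda>_. 0" t k] zero that by simp
  then have "norm (f n) \<le> 0 * 0"
    by (intro norm_le_of_dirichlet_le[OF f, of "\<lambda>_. 0"]) (simp_all add: abs_conv_beyond_def)
  then show ?thesis by simp
qed

section \<open>Criteria for absolute convergence\<close>

lemma abs_conv_beyond_if_bounded:
  fixes f :: "nat \<Rightarrow> 'a::real_normed_vector"
  assumes "\<And>m. norm (f m) \<le> B * exp (\<omega> * real m)"
  shows "abs_conv_beyond \<omega> f"
  unfolding abs_conv_beyond_def
proof (intro allI impI)
  fix t assume t: "t > \<omega>"
  show "summable (\<lambda>m. exp (- t * real m) * norm (f m))"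
  proof (rule summable_comparison_test')
    show "summable (\<lambda>m. B * exp (\<omega> - t) ^ m)"
      using t by (intro summable_mult summable_geometric) simp
    fix m
    have "exp (- t * real m) * norm (f m) \<le> exp (- t * real m) * (B * exp (\<omega> * real m))"
      by (intro mult_left_mono assms) simp
    also have "\<dots> = B * exp (\<omega> - t) ^ m"
      by (simp add: algebra_simps flip: exp_of_nat_mult exp_add)
    finally show "norm (exp (- t * real m) * norm (f m)) \<le> B * exp (\<omega> - t) ^ m"
      by simp
  qed
qed

text \<open>As in Abel's lemma for power series: convergence at some \<open>s < t\<close> bounds the
  terms at \<open>s\<close>, and passing from \<open>s\<close> to \<open>t\<close> adds geometric
  decay.\<close>

lemma abs_conv_beyond_if_conv:
  fixes f :: "nat \<Rightarrow> 'a::real_normed_vector"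
  assumes "\<And>t. t > \<omega> \<Longrightarrow> summable (\<lambda>m. exp (- t * real m) *\<^sub>R f m)"
  shows "abs_conv_beyond \<omega> f"
  unfolding abs_conv_beyond_def
proof (intro allI impI)
  fix t assume "t > \<omega>"
  then obtain s where s: "\<omega> < s" "s < t" using dense by blast
  from assms[OF s(1)] have "Bseq (\<lambda>m. exp (- s * real m) *\<^sub>R f m)"
    by (intro convergent_imp_Bseq convergentI[OF summable_LIMSEQ_zero])
  then obtain B where "\<And>m. norm (exp (- s * real m) *\<^sub>R f m) \<le> B"
    by (auto simp only: Bseq_def)
  then have "norm (f m) \<le> B * exp (s * real m)" for m
    by (simp add: exp_minus field_simps)
  then show "summable (\<lambda>m. exp (- t * real m) * norm (f m))"
    using abs_conv_beyond_if_bounded[of f B s] s by (simp add: abs_conv_beyond_def)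
qed

section \<open>The substitution \<lambda> = exp t\<close>

lemma of_real_exp_powi:
  "complex_of_real (exp t) powi (- int m) = complex_of_real (exp (- t * real m))"
  by (simp add: power_int_minus exp_minus exp_of_nat2_mult)

lemma scaleC_exp_powi:
  "(complex_of_real (exp t) powi (- int m)) *\<^sub>C x = exp (- t * real m) *\<^sub>R x"
  by (simp only: scaleR_scaleC of_real_exp_powi)

lemma ztransform_converges_exp:
  "ztransform_converges f (complex_of_real (exp t)) \<longleftrightarrow> summable (\<lambda>m. exp (- t * real m) *\<^sub>R f m)"
  by (simp only: ztransform_converges_def scaleC_exp_powi)

lemma ztransform_exp: "ztransform f (complex_of_real (exp t)) = dirichlet 0 f t"
  unfolding ztransform_def scaleC_exp_powi dirichlet_def by simp

lemma mult_p_seq_exp: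
  "complex_of_real (exp t) * p_seq (complex_of_real (exp t)) m = complex_of_real (exp (- t * real m))"
proof -
  have "complex_of_real (exp t) * p_seq (complex_of_real (exp t)) m
      = complex_of_real (exp t) powi (- int m)"
    using power_int_add_1'[of "complex_of_real (exp t)" "- (int m + 1)"]
    by (simp add: p_seq_def)
  also have "\<dots> = complex_of_real (exp (- t * real m))"
    by (rule of_real_exp_powi)
  finally show ?thesis .
qed

lemma all_greater_exp_iff:
  fixes a :: real
  assumes "a > 0"
  shows "(\<forall>l>a. P l) \<longleftrightarrow> (\<forall>t>ln a. P (exp t))"
proof (intro iffI allI impI)
  fix t assume "\<forall>l>a. P l" "t > ln a"
  then show "P (exp t)" using assms by (metis exp_less_cancel_iff exp_ln)
next
  fix l assume "\<forall>t>ln a. P (exp t)" "l > a"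
  then show "P l" using assms by (metis exp_ln ln_less_cancel_iff order_less_trans)
qed

section \<open>Finite suprema as real inequalities\<close>

text \<open>Serves both the supremum in (i) and the Widder norm; positivity of \<open>v\<close>
  allows the quotient to be cleared.\<close>

lemma SUP_ennreal_divide_less_top_iff:
  fixes u v :: "'b \<Rightarrow> real"
  assumes "\<And>x. x \<in> A \<Longrightarrow> v x > 0"
  shows "(SUP x\<in>A. ennreal (u x / v x)) < \<infinity> \<longleftrightarrow> (\<exists>M\<ge>0. \<forall>x\<in>A. u x \<le> M * v x)"
proof
  assume fin: "(SUP x\<in>A. ennreal (u x / v x)) < \<infinity>"
  define M where "M = enn2real (SUP x\<in>A. ennreal (u x / v x))"
  have "u x \<le> M * v x" if "x \<in> A" for x
  proof -
    have "ennreal (u x / v x) \<le> ennreal M"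
      unfolding M_def using fin SUP_upper[OF that, of "\<lambda>x. ennreal (u x / v x)"] by simp
    \<comment> \<open>\<open>ennreal\<close> sends negative reals to 0, so a nonpositive quotient is
      handled separately, by nonnegativity of \<open>M\<close>.\<close>
    then have "u x / v x \<le> M"
      by (auto simp: M_def ennreal_le_iff2 intro: order_trans[OF _ enn2real_nonneg])
    then show ?thesis using assms[OF that] by (simp add: field_simps)
  qed
  moreover have "M \<ge> 0" by (simp add: M_def)
  ultimately show "\<exists>M\<ge>0. \<forall>x\<in>A. u x \<le> M * v x" by blast
next
  assume "\<exists>M\<ge>0. \<forall>x\<in>A. u x \<le> M * v x"
  then obtain M where "\<And>x. x \<in> A \<Longrightarrow> u x \<le> M * v x" by blast
  then have "(SUP x\<in>A. ennreal (u x / v x)) \<le> ennreal M"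
    using assms by (intro SUP_least ennreal_leI) (simp add: field_simps)
  then show "(SUP x\<in>A. ennreal (u x / v x)) < \<infinity>"
    unfolding infinity_ennreal_def by (rule le_less_trans[OF _ ennreal_less_top])
qed

section \<open>Bounded linear maps on the weighted sequence space\<close>

definition unit_seq :: "nat \<Rightarrow> nat \<Rightarrow> complex" where
  "unit_seq n m = (if m = n then 1 else 0)"

lemma l1_if_finite_support: "finite A \<Longrightarrow> (\<And>m. m \<notin> A \<Longrightarrow> g m = 0) \<Longrightarrow> g \<in> l1 \<phi>"
  unfolding l1_def by (auto intro!: summable_finite)

lemma l1_norm_unit_seq: "l1_norm \<phi> (unit_seq n) = \<phi> n"
proof -
  have "(\<Sum>m. \<phi> m * cmod (unit_seq n m)) = (\<Sum>m\<in>{n}. \<phi> m * cmod (unit_seq n m))"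
    by (rule suminf_finite) (auto simp: unit_seq_def)
  then show ?thesis by (simp add: l1_norm_def unit_seq_def)
qed

text \<open>Linearity evaluates \<theta> on finite truncations of \<open>g\<close>; what remains is
  a tail whose norm tends to 0, and \<theta> is bounded.\<close>

lemma bounded_clinear_l1_sums:
  assumes \<theta>: "bounded_clinear_l1 \<phi> \<theta>" and g: "g \<in> l1 \<phi>"
  shows "(\<lambda>m. g m *\<^sub>C \<theta> (unit_seq m)) sums \<theta> g"
proof -
  from \<theta> obtain K where add: "\<And>g h. g \<in> l1 \<phi> \<Longrightarrow> h \<in> l1 \<phi> \<Longrightarrow> \<theta> (\<lambda>n. g n + h n) = \<theta> g + \<theta> h"
    and scale: "\<And>c g. g \<in> l1 \<phi> \<Longrightarrow> \<theta> (\<lambda>n. c * g n) = c *\<^sub>C \<theta> g"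
    and bound: "\<And>g. g \<in> l1 \<phi> \<Longrightarrow> norm (\<theta> g) \<le> K * l1_norm \<phi> g"
    unfolding bounded_clinear_l1_def by blast
  define h where "h = (\<lambda>N m. if m < N then g m else 0)"
  define r where "r = (\<lambda>N m. if m < N then 0 else g m)"
  have h_l1: "h N \<in> l1 \<phi>" for N
    by (rule l1_if_finite_support[of "{..<N}"]) (auto simp: h_def)
  have unit_l1: "unit_seq n \<in> l1 \<phi>" for n
    by (rule l1_if_finite_support[of "{n}"]) (auto simp: unit_seq_def)
  have h_eq: "\<theta> (h N) = (\<Sum>m<N. g m *\<^sub>C \<theta> (unit_seq m))" for N
  proof (induction N)
    case 0
    \<comment> \<open>That \<theta> maps the zero sequence to 0 is read off from the norm
      bound.\<close>
    have "l1_norm \<phi> (h 0) = 0" by (simp add: l1_norm_def h_def)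
    then show ?case using bound[OF h_l1, of 0] by simp
  next
    case (Suc N)
    have unit_l1': "(\<lambda>m. g N * unit_seq N m) \<in> l1 \<phi>"
      by (rule l1_if_finite_support[of "{N}"]) (auto simp: unit_seq_def)
    have "h (Suc N) = (\<lambda>m. h N m + g N * unit_seq N m)"
      by (auto simp: h_def unit_seq_def fun_eq_iff less_Suc_eq)
    then show ?case
      using add[OF h_l1 unit_l1', of N] scale[OF unit_l1] Suc by simp
  qed
  \<comment> \<open>The norm of the tail \<open>r N\<close> is computed as the whole series of
    \<open>G\<close> minus its first \<open>N\<close> terms.\<close>
  define G where "G = (\<lambda>m. \<phi> m * cmod (g m))"
  have r_sums: "(\<lambda>m. \<phi> m * cmod (r N m)) sums (suminf G - sum G {..<N})" for N
  proof -
    have "(\<lambda>m. G m - (if m \<in> {..<N} then G m else 0)) sums (suminf G - sum G {..<N})"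
      using g by (intro sums_diff summable_sums sums_If_finite_set) (auto simp: G_def l1_def)
    also have "(\<lambda>m. G m - (if m \<in> {..<N} then G m else 0)) = (\<lambda>m. \<phi> m * cmod (r N m))"
      by (auto simp: G_def r_def)
    finally show ?thesis .
  qed
  have r_l1: "r N \<in> l1 \<phi>" and r_norm: "l1_norm \<phi> (r N) = suminf G - sum G {..<N}" for N
    using r_sums[of N] by (auto simp: l1_def l1_norm_def sums_iff)
  have "\<theta> g = \<theta> (h N) + \<theta> (r N)" for N
    using add[OF h_l1 r_l1, of N N] by (simp add: h_def r_def if_distrib cong: if_cong)
  then have diff: "norm ((\<Sum>m<N. g m *\<^sub>C \<theta> (unit_seq m)) - \<theta> g) \<le> K * (suminf G - sum G {..<N})" for N
    using bound[OF r_l1, of N] by (simp add: h_eq r_norm) (metis add_diff_cancel_left' norm_minus_commute)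
  have "(\<lambda>N. K * (suminf G - sum G {..<N})) \<longlonglongrightarrow> K * (suminf G - suminf G)"
    using g by (intro tendsto_intros summable_LIMSEQ) (simp add: G_def l1_def)
  then have lim: "(\<lambda>N. K * (suminf G - sum G {..<N})) \<longlonglongrightarrow> 0"
    by (simp only: diff_self mult_zero_right)
  have "(\<lambda>N. (\<Sum>m<N. g m *\<^sub>C \<theta> (unit_seq m)) - \<theta> g) \<longlonglongrightarrow> 0"
    by (rule Lim_null_comparison[OF always_eventually lim]) (blast intro: diff)
  then show ?thesis
    unfolding sums_def by (rule LIM_zero_cancel)
qed

text \<open>The terms satisfy
  \<open>norm (g n *\<^sub>C f n) \<le> M * (\<phi> n * cmod (g n))\<close>, so the series converges
  absolutely on \<open>l1 \<phi>\<close>, with \<open>M\<close> as a bound for the map.\<close>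

lemma bounded_clinear_l1_if_bounded:
  fixes f :: "nat \<Rightarrow> 'a::cbanach"
  assumes \<phi>: "\<And>n. \<phi> n > 0" and f: "\<And>n. norm (f n) \<le> M * \<phi> n"
  shows "bounded_clinear_l1 \<phi> (\<lambda>g. \<Sum>n. g n *\<^sub>C f n)"
proof -
  have le: "norm (g n *\<^sub>C f n) \<le> M * (\<phi> n * cmod (g n))" for g n
    using mult_left_mono[OF f[of n], of "cmod (g n)"] by (simp add: norm_scaleC mult_ac)
  have sn: "summable (\<lambda>n. norm (g n *\<^sub>C f n))" if "g \<in> l1 \<phi>" for g
    by (rule summable_comparison_test'[OF summable_mult[of _ M]])
      (use le that in \<open>auto simp: l1_def\<close>)
  have s: "summable (\<lambda>n. g n *\<^sub>C f n)" if "g \<in> l1 \<phi>" for g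
    by (rule summable_norm_cancel[OF sn[OF that]])
  \<comment> \<open>Complex scaling is in particular a bounded real-linear map, which is what
    commutes with infinite sums.\<close>
  have lin: "bounded_linear (\<lambda>x::'a. c *\<^sub>C x)" for c
  proof (rule bounded_linear_intro)
    show "c *\<^sub>C (r *\<^sub>R x) = r *\<^sub>R (c *\<^sub>C x)" for r and x :: 'a
      by (simp add: scaleR_scaleC scaleC_scaleC mult.commute)
    show "norm (c *\<^sub>C x) \<le> norm x * cmod c" for x :: 'a
      by (simp add: norm_scaleC)
  qed (rule scaleC_add_right)
  have "norm (\<Sum>n. g n *\<^sub>C f n) \<le> M * l1_norm \<phi> g" if "g \<in> l1 \<phi>" for g
  proof -
    have "norm (\<Sum>n. g n *\<^sub>C f n) \<le> (\<Sum>n. norm (g n *\<^sub>C f n))"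
      by (rule summable_norm[OF sn[OF that]])
    also have "\<dots> \<le> (\<Sum>n. M * (\<phi> n * cmod (g n)))"
      by (rule suminf_le[OF _ sn[OF that]], rule le) (use that in \<open>auto simp: l1_def intro: summable_mult\<close>)
    also have "\<dots> = M * l1_norm \<phi> g"
      unfolding l1_norm_def by (rule suminf_mult) (use that in \<open>auto simp: l1_def\<close>)
    finally show ?thesis .
  qed
  then show ?thesis
    unfolding bounded_clinear_l1_def
  proof (intro conjI ballI allI exI)
    fix g h assume gh: "g \<in> l1 \<phi>" "h \<in> l1 \<phi>"
    show "(\<Sum>n. (g n + h n) *\<^sub>C f n) = (\<Sum>n. g n *\<^sub>C f n) + (\<Sum>n. h n *\<^sub>C f n)"
      unfolding scaleC_add_left by (rule suminf_add[OF s[OF gh(1)] s[OF gh(2)], symmetric])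
  next
    fix c g assume "g \<in> l1 \<phi>"
    then show "(\<Sum>n. (c * g n) *\<^sub>C f n) = c *\<^sub>C (\<Sum>n. g n *\<^sub>C f n)"
      unfolding scaleC_scaleC[symmetric] by (intro bounded_linear.suminf[OF lin, symmetric] s)
  qed
qed

section \<open>The Widder space and the bound on the coefficients\<close>

lemma l1_norm_beta_seq:
  "l1_norm \<phi> (beta_seq k t) = (\<Sum>m. real m ^ k * exp (- t * real m) * \<phi> m)"
  unfolding l1_norm_def beta_seq_def by (simp add: norm_mult norm_power mult_ac)

lemma widder_space_iff_dirichlet_le:
  fixes f :: "nat \<Rightarrow> 'a::banach"
  assumes f: "abs_conv_beyond \<omega> f" and \<phi>: "abs_conv_beyond \<omega> \<phi>" "\<And>n. \<phi> n > 0"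
    and r: "\<And>t. t > \<omega> \<Longrightarrow> r t = dirichlet 0 f t"
  shows "r \<in> widder_space \<phi> \<omega> \<longleftrightarrow>
    (\<exists>M\<ge>0. \<forall>k. \<forall>t>\<omega>. norm (dirichlet k f t) \<le> M * l1_norm \<phi> (beta_seq k t))"
proof -
  note deriv = iter_deriv_dirichlet[OF f r]
  have smooth: "r \<in> C_infinity \<omega>"
    unfolding C_infinity_def using deriv(2) differentiableI_vector by blast
  have pos: "l1_norm \<phi> (beta_seq k t) > 0" if "t > \<omega>" for k t
    unfolding l1_norm_beta_seq
  \<comment> \<open>The term at \<open>m = 1\<close> is positive for every \<open>k\<close>, whereas
    the one at \<open>m = 0\<close> vanishes as soon as \<open>k > 0\<close>.\<close>
  proof (rule suminf_pos2[where i = 1])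
    show "summable (\<lambda>m. real m ^ k * exp (- t * real m) * \<phi> m)"
      using abs_conv_beyond_power[OF \<phi>(1) that, of k] \<phi>(2) by (simp add: less_imp_le)
  qed (use \<phi>(2) in \<open>auto simp: less_imp_le\<close>)
  have "widder_norm \<phi> \<omega> r < \<infinity> \<longleftrightarrow>
    (\<exists>M\<ge>0. \<forall>(k, t) \<in> UNIV \<times> {\<omega><..}. norm (iter_deriv k r t) \<le> M * l1_norm \<phi> (beta_seq k t))"
    unfolding widder_norm_def
    using SUP_ennreal_divide_less_top_iff[of "UNIV \<times> {\<omega><..}"
        "\<lambda>x. l1_norm \<phi> (beta_seq (fst x) (snd x))" "\<lambda>x. norm (iter_deriv (fst x) r (snd x))",
        OF pos]
    by (auto simp: case_prod_unfold mem_Times_iff)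
  also have "\<dots> \<longleftrightarrow> (\<exists>M\<ge>0. \<forall>k. \<forall>t>\<omega>. norm (dirichlet k f t) \<le> M * l1_norm \<phi> (beta_seq k t))"
    by (auto simp: deriv(1))
  finally show ?thesis
    using smooth by (simp add: widder_space_def)
qed

text \<open>The derivative bounds and the coefficient bound are equivalent with the same constant
  \<open>M\<close>: localisation gives one direction, termwise estimation the other.\<close>

lemma widder_space_iff_bounded:
  fixes f :: "nat \<Rightarrow> 'a::banach"
  assumes f: "abs_conv_beyond \<omega> f" and \<phi>: "abs_conv_beyond \<omega> \<phi>" "\<And>n. \<phi> n > 0"
    and r: "\<And>t. t > \<omega> \<Longrightarrow> r t = dirichlet 0 f t"
  shows "r \<in> widder_space \<phi> \<omega> \<longleftrightarrow> (\<exists>M\<ge>0. \<forall>n. norm (f n) \<le> M * \<phi> n)"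
proof -
  have "(\<forall>k. \<forall>t>\<omega>. norm (dirichlet k f t) \<le> M * l1_norm \<phi> (beta_seq k t))
      \<longleftrightarrow> (\<forall>n. norm (f n) \<le> M * \<phi> n)" for M
  proof (intro iffI allI impI)
    fix n assume "\<forall>k. \<forall>t>\<omega>. norm (dirichlet k f t) \<le> M * l1_norm \<phi> (beta_seq k t)"
    then show "norm (f n) \<le> M * \<phi> n"
      unfolding l1_norm_beta_seq by (intro norm_le_of_dirichlet_le[OF f \<phi>(1)]) blast
  next
    fix k t assume le: "\<forall>n. norm (f n) \<le> M * \<phi> n" and t: "t > \<omega>"
    have s: "summable (\<lambda>m. real m ^ k * exp (- t * real m) * norm (f m))"
      "summable (\<lambda>m. real m ^ k * exp (- t * real m) * \<phi> m)"
      using abs_conv_beyond_power[OF f t, of k] abs_conv_beyond_power[OF \<phi>(1) t, of k] \<phi>(2)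
      by (simp_all add: less_imp_le)
    have "norm (dirichlet k f t)
        \<le> (\<Sum>m. norm (((- real m) ^ k * exp (- t * real m)) *\<^sub>R f m))"
      unfolding dirichlet_def
      by (rule summable_norm) (use s(1) in \<open>simp add: abs_mult power_abs\<close>)
    also have "\<dots> = (\<Sum>m. real m ^ k * exp (- t * real m) * norm (f m))"
      by (simp add: abs_mult power_abs)
    also have "\<dots> \<le> (\<Sum>m. M * (real m ^ k * exp (- t * real m) * \<phi> m))"
    proof (rule suminf_le[OF _ s(1) summable_mult[OF s(2)]])
      fix m
      show "real m ^ k * exp (- t * real m) * norm (f m)
          \<le> M * (real m ^ k * exp (- t * real m) * \<phi> m)"
        using mult_left_mono[OF le[rule_format, of m], of "real m ^ k * exp (- t * real m)"]
        by (simp only: mult.left_commute[of M]) simp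
    qed
    also have "\<dots> = M * l1_norm \<phi> (beta_seq k t)"
      unfolding l1_norm_beta_seq by (rule suminf_mult[OF s(2)])
    finally show "norm (dirichlet k f t) \<le> M * l1_norm \<phi> (beta_seq k t)" .
  qed
  with widder_space_iff_dirichlet_le[of \<omega> f \<phi> r, OF assms] show ?thesis
    by (simp only:)
qed

section \<open>From a bounded map to the bound on the coefficients\<close>

text \<open>This sequence is \<open>\<lambda> p_\<lambda>\<close> at \<lambda> = exp t; membership
  allows \<theta> to be expanded along the unit sequences.\<close>

lemma exp_seq_in_l1:
  assumes "abs_conv_beyond \<omega> \<phi>" "\<And>n. \<phi> n > 0" "t > \<omega>"
  shows "(\<lambda>m. complex_of_real (exp (- t * real m))) \<in> l1 \<phi>"
  using assms by (simp add: l1_def abs_conv_beyond_def less_imp_le mult.commute)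

text \<open>The values \<open>u n\<close> of \<theta> at the unit sequences obey the bound, as these
  have norm \<open>\<phi> n\<close>. Expanding \<theta> shows that \<open>f\<close> and
  \<open>u\<close> have the same Dirichlet series, hence the same coefficients.\<close>

lemma bounded_if_l1_map_eq_ztransform:
  fixes f :: "nat \<Rightarrow> 'a::cbanach"
  assumes \<phi>: "\<And>n. \<phi> n > 0" "\<And>n. \<phi> n \<le> C * exp (\<omega> * real n)"
    and f: "abs_conv_beyond \<omega> f" and \<theta>: "bounded_clinear_l1 \<phi> \<theta>"
    and eq: "\<And>t. t > \<omega> \<Longrightarrow> \<theta> (\<lambda>m. complex_of_real (exp (- t * real m))) = dirichlet 0 f t"
  shows "\<exists>M\<ge>0. \<forall>n. norm (f n) \<le> M * \<phi> n"
proof -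
  define u where "u = (\<lambda>n. \<theta> (unit_seq n))"
  obtain K where "\<And>g. g \<in> l1 \<phi> \<Longrightarrow> norm (\<theta> g) \<le> K * l1_norm \<phi> g"
    using \<theta> unfolding bounded_clinear_l1_def by blast
  moreover have "unit_seq n \<in> l1 \<phi>" for n
    by (rule l1_if_finite_support[of "{n}"]) (auto simp: unit_seq_def)
  ultimately have "norm (u n) \<le> K * \<phi> n" for n
    unfolding u_def using l1_norm_unit_seq by metis
  \<comment> \<open>The constant of a bounded map comes without a sign condition; its absolute value
    supplies the \<open>M \<ge> 0\<close> of the conclusion.\<close>
  moreover have "K * \<phi> n \<le> \<bar>K\<bar> * \<phi> n" for n
    using \<phi>(1)[of n] by (intro mult_right_mono) auto
  ultimately have u_le: "norm (u n) \<le> \<bar>K\<bar> * \<phi> n" for n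
    using order_trans by blast
  have \<phi>_conv: "abs_conv_beyond \<omega> \<phi>"
    by (rule abs_conv_beyond_if_bounded[of _ C]) (use \<phi> in \<open>simp add: less_imp_le\<close>)
  have u_conv: "abs_conv_beyond \<omega> u"
  proof (rule abs_conv_beyond_if_bounded)
    show "norm (u n) \<le> (\<bar>K\<bar> * C) * exp (\<omega> * real n)" for n
      using order_trans[OF u_le mult_left_mono[OF \<phi>(2)]] by (simp add: mult.assoc)
  qed
  \<comment> \<open>Plain convergence passes to differences at once and is then upgraded to absolute
    convergence.\<close>
  have diff_conv: "abs_conv_beyond \<omega> (\<lambda>n. f n - u n)"
  proof (rule abs_conv_beyond_if_conv)
    fix t assume t: "t > \<omega>"
    show "summable (\<lambda>m. exp (- t * real m) *\<^sub>R (f m - u m))"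
      using summable_diff[OF summable_dirichlet[OF f t, of 0] summable_dirichlet[OF u_conv t, of 0]]
      by (simp add: scaleR_diff_right)
  qed
  have "dirichlet 0 (\<lambda>n. f n - u n) t = 0" if t: "t > \<omega>" for t
  proof -
    have "\<theta> (\<lambda>m. complex_of_real (exp (- t * real m))) = dirichlet 0 u t"
      using bounded_clinear_l1_sums[OF \<theta> exp_seq_in_l1[OF \<phi>_conv \<phi>(1) t]]
      by (simp add: sums_iff dirichlet_def u_def flip: scaleR_scaleC)
    then have "dirichlet 0 f t - dirichlet 0 u t = 0"
      using eq[OF t] by simp
    moreover have "dirichlet 0 f t - dirichlet 0 u t = dirichlet 0 (\<lambda>n. f n - u n) t"
      unfolding dirichlet_def scaleR_diff_right
      by (rule suminf_diff[OF summable_dirichlet[OF f t] summable_dirichlet[OF u_conv t]])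
    ultimately show ?thesis by simp
  qed
  then have "f n - u n = 0" for n
    by (rule dirichlet_zero_imp_zero[OF diff_conv])
  then have "norm (f n) \<le> \<bar>K\<bar> * \<phi> n" for n
    using u_le[of n] by simp
  then show ?thesis
    by (intro exI[of _ "\<bar>K\<bar>"]) simp
qed

section \<open>Equivalence of the three assertions\<close>

theorem theorem1:
  fixes f :: "nat \<Rightarrow> 'a::cbanach"
    and \<phi> :: "nat \<Rightarrow> real"
    and C a :: real
  assumes "\<forall>n. \<phi> n > 0"
    and "C > 0"
    and "a > 0"
    and "\<forall>n. \<phi> n \<le> C * a ^ n"
  defines "i \<equiv> (SUP n. ennreal (norm (f n) / \<phi> n)) < \<infinity>"
    and "ii \<equiv> (\<forall>l::real. l > a \<longrightarrow> ztransform_converges f (complex_of_real l)) \<and>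
      (\<exists>\<theta> :: (nat \<Rightarrow> complex) \<Rightarrow> 'a. bounded_clinear_l1 \<phi> \<theta> \<and>
         (\<forall>l::real. l > a \<longrightarrow>
            \<theta> (\<lambda>n. complex_of_real l * p_seq (complex_of_real l) n)
              = ztransform f (complex_of_real l)))"
    and "iii \<equiv> (\<forall>l::real. l > a \<longrightarrow> ztransform_converges f (complex_of_real l)) \<and>
      (\<lambda>l::real. ztransform f (complex_of_real l)) \<circ> exp \<in> widder_space \<phi> (ln a)"
  shows "(i \<longleftrightarrow> ii) \<and> (ii \<longleftrightarrow> iii)"
proof -
  define \<omega> where "\<omega> = ln a"
  \<comment> \<open>\<open>bdd\<close> is the real form of (i), with which (ii) and (iii) are
    compared; \<open>conv\<close> is their shared convergence clause in the variable
    \<open>t\<close>.\<close>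
  define bdd where "bdd \<longleftrightarrow> (\<exists>M\<ge>0. \<forall>n. norm (f n) \<le> M * \<phi> n)"
  define conv where "conv \<longleftrightarrow> (\<forall>t>\<omega>. summable (\<lambda>m. exp (- t * real m) *\<^sub>R f m))"
  have pos: "\<phi> n > 0" for n
    using assms(1) by blast
  have "a ^ n = exp (\<omega> * real n)" for n
    using \<open>a > 0\<close> by (simp add: \<omega>_def exp_of_nat2_mult)
  then have \<phi>_le: "\<phi> n \<le> C * exp (\<omega> * real n)" for n
    using assms(4) by metis
  have \<phi>_conv: "abs_conv_beyond \<omega> \<phi>"
    by (rule abs_conv_beyond_if_bounded[of _ C]) (use pos \<phi>_le in \<open>simp add: less_imp_le\<close>)
  have i: "i \<longleftrightarrow> bdd"
    unfolding i_def bdd_def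
    using SUP_ennreal_divide_less_top_iff[of UNIV \<phi> "\<lambda>n. norm (f n)"] pos by simp
  have ii: "ii \<longleftrightarrow> conv \<and> (\<exists>\<theta> :: (nat \<Rightarrow> complex) \<Rightarrow> 'a. bounded_clinear_l1 \<phi> \<theta> \<and>
      (\<forall>t>\<omega>. \<theta> (\<lambda>m. complex_of_real (exp (- t * real m))) = dirichlet 0 f t))"
    unfolding ii_def conv_def \<omega>_def all_greater_exp_iff[OF \<open>a > 0\<close>]
      ztransform_converges_exp ztransform_exp mult_p_seq_exp ..
  have iii: "iii \<longleftrightarrow> conv \<and> (\<lambda>t. dirichlet 0 f t) \<in> widder_space \<phi> \<omega>"
    unfolding iii_def conv_def \<omega>_def all_greater_exp_iff[OF \<open>a > 0\<close>] comp_def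
      ztransform_converges_exp ztransform_exp ..
  have f_conv: "abs_conv_beyond \<omega> f" if conv
    by (rule abs_conv_beyond_if_conv) (use that in \<open>simp add: conv_def\<close>)
  \<comment> \<open>The bound together with \<open>\<phi> n \<le> C * a ^ n\<close> limits the
    growth of \<open>f\<close> to the exponential rate \<omega>, which yields the convergence
    clause.\<close>
  have bdd_conv: conv if bdd
  proof -
    from that obtain M where M: "M \<ge> 0" "\<And>n. norm (f n) \<le> M * \<phi> n"
      unfolding bdd_def by blast
    have "norm (f n) \<le> (M * C) * exp (\<omega> * real n)" for n
      using order_trans[OF M(2) mult_left_mono[OF \<phi>_le M(1)]] by (simp add: mult.assoc)
    then have "abs_conv_beyond \<omega> f"
      by (rule abs_conv_beyond_if_bounded)
    then show conv
      unfolding conv_def using summable_dirichlet[of \<omega> f _ 0] by simp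
  qed
  have "iii \<longleftrightarrow> bdd"
    unfolding iii using widder_space_iff_bounded[OF f_conv \<phi>_conv pos] bdd_conv
    unfolding bdd_def by blast
  moreover have "ii \<longleftrightarrow> bdd"
  proof
    assume ii
    then show bdd
      unfolding ii bdd_def using bounded_if_l1_map_eq_ztransform[OF pos \<phi>_le f_conv] by blast
  next
    assume bdd
    then obtain M where "\<And>n. norm (f n) \<le> M * \<phi> n"
      unfolding bdd_def by blast
    \<comment> \<open>The witness for \<theta> pairs \<open>g\<close> with \<open>f\<close>; at
      \<open>\<lambda> p_\<lambda>\<close> this pairing is the Z-transform itself.\<close>
    then have "bounded_clinear_l1 \<phi> (\<lambda>g. \<Sum>n. g n *\<^sub>C f n)"
      by (rule bounded_clinear_l1_if_bounded[OF pos])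
    moreover have "(\<Sum>m. complex_of_real (exp (- t * real m)) *\<^sub>C f m) = dirichlet 0 f t" for t
      by (simp add: dirichlet_def flip: scaleR_scaleC)
    ultimately show ii
      unfolding ii using bdd_conv[OF \<open>bdd\<close>] by blast
  qed
  ultimately show ?thesis
    using i by blast
qed

end
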